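(* Let $f$ and $q$ be probability density functions on $\mathbb{R}^d$ (with respect to Lebesgue measure) such that $q$ dominates $f$. Let $X$ be a random variable with density $q$ and set $W(X) = f(X)/q(X)$. Then for all $\eta \in (0,1]$, $$\mathbb{E}[W(X)^\eta] \leq 1 \quad\text{and}\quad \mathrm{Var}[W(X)^\eta] \leq \mathrm{Var}[W(X)].$$ Moreover, if $q \neq f$, then both inequalities become equalities if and only if $\eta = 1$.
   Context: "$q$ dominates $f$" means that the distribution with density $f$ is absolutely continuous with respect to the one with density $q$. Densities are identified when they agree Lebesgue-almost everywhere, so $q\neq f$ means that they do not agree almost everywhere. Variances take values in $[0,+\infty]$. The last assertion says: the two inequalities are simultaneously equalities if and only if $\eta=1$. *)

theory Defs
  imports "HOL-Probability.Probability"
begin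

definition prob_density :: "('a::euclidean_space \<Rightarrow> real) \<Rightarrow> bool" where
  "prob_density f \<longleftrightarrow>
     f \<in> borel_measurable borel \<and> (\<forall>x. 0 \<le> f x) \<and> (\<integral>\<^sup>+ x. ennreal (f x) \<partial>lborel) = 1"

(* absolutely_continuous M N is N << M: the dominating measure comes first. *)
definition dominates ::
  "('a::euclidean_space \<Rightarrow> real) \<Rightarrow> ('a \<Rightarrow> real) \<Rightarrow> bool" where
  "dominates q f \<longleftrightarrow>
     absolutely_continuous (density lborel (\<lambda>x. ennreal (q x)))
                           (density lborel (\<lambda>x. ennreal (f x)))"

(* The library's prob_space.variance is a Bochner integral and hence 0 for variables without
   a second moment; this version takes the value infinity there. *)
definition ext_variance :: "'w measure \<Rightarrow> ('w \<Rightarrow> real) \<Rightarrow> ennreal" where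
  "ext_variance M Y =
     (if integrable M Y
      then \<integral>\<^sup>+ \<omega>. ennreal ((Y \<omega> - (\<integral>\<omega>'. Y \<omega>' \<partial>M))\<^sup>2) \<partial>M
      else \<infinity>)"

end

theory Submission imports Defs begin

text \<open>Put \<open>Z = W \<circ> X\<close>. Since \<open>q\<close> dominates \<open>f\<close>, \<open>E Z = 1\<close>. Bernoulli's inequality
  \<open>z powr \<eta> \<le> 1 + \<eta> (z - 1)\<close> gives the bound on the mean, and its strictness off \<open>z = 1\<close> for \<open>\<eta> < 1\<close>
  shows that equality of the means alone already forces \<open>Z = 1\<close> almost surely, that is, \<open>f = q\<close>.
  For the variances, \<open>Var (Z powr \<eta>) \<le> E (Z powr \<eta> - 1)\<^sup>2 \<le> E (Z - 1)\<^sup>2 = Var Z\<close>, because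
  \<open>\<bar>z powr \<eta> - 1\<bar> \<le> \<bar>z - 1\<bar>\<close>.\<close>

text \<open>With \<open>x = exp L\<close>, the bound \<open>1 + t < exp t\<close> is used at
  \<open>t = (1 - \<eta>) * L\<close> and \<open>t = - (\<eta> * L)\<close>. Weights
  \<open>\<eta>\<close> and \<open>1 - \<eta>\<close> cancel the linear terms, and multiplying by
  \<open>exp (\<eta> * L)\<close> gives the claim. The point \<open>x = 0\<close> has no logarithm
  and is treated apart.\<close>

lemma powr_less_Bernoulli:
  fixes x \<eta> :: real
  assumes "0 \<le> x" "x \<noteq> 1" "0 < \<eta>" "\<eta> < 1"
  shows "x powr \<eta> < 1 + \<eta> * (x - 1)"
proof (cases "x = 0")
  case True
  then show ?thesis using assms by simp
next
  case False
  define L where "L = ln x"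
  have x: "x = exp L" and L: "L \<noteq> 0" and p: "x powr \<eta> = exp (\<eta> * L)"
    using False assms by (auto simp: L_def powr_def)
  \<comment> \<open>Strictness holds because \<open>ln y = y - 1\<close> forces
    \<open>y = 1\<close>, here with \<open>y = exp t\<close>.\<close>
  have strict: "1 + t < exp t" if "t \<noteq> 0" for t :: real
    using that ln_eq_minus_one[of "exp t"] by (auto simp: less_le)
  have "1 + - (\<eta> * L) < exp (- (\<eta> * L))"
    using strict[of "- (\<eta> * L)"] L assms by simp
  moreover have "1 + (1 - \<eta>) * L < exp ((1 - \<eta>) * L)"
    using strict[of "(1 - \<eta>) * L"] L assms by simp
  ultimately have
    "\<eta> * (1 + (1 - \<eta>) * L) + (1 - \<eta>) * (1 + - (\<eta> * L))
       < \<eta> * exp ((1 - \<eta>) * L) + (1 - \<eta>) * exp (- (\<eta> * L))"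
    using assms by (intro add_strict_mono mult_strict_left_mono) auto
  then have "1 < \<eta> * exp ((1 - \<eta>) * L) + (1 - \<eta>) * exp (- (\<eta> * L))"
    by (simp add: algebra_simps)
  then have "exp (\<eta> * L) * 1
      < exp (\<eta> * L) * (\<eta> * exp ((1 - \<eta>) * L) + (1 - \<eta>) * exp (- (\<eta> * L)))"
    by (intro mult_strict_left_mono) auto
  also have "\<dots> = \<eta> * (exp (\<eta> * L) * exp ((1 - \<eta>) * L))
      + (1 - \<eta>) * (exp (\<eta> * L) * exp (- (\<eta> * L)))"
    by (simp add: algebra_simps)
  also have "\<dots> = \<eta> * x + (1 - \<eta>)"
    by (simp add: x exp_add[symmetric] algebra_simps)
  finally show ?thesis by (simp add: p algebra_simps)
qed

lemma powr_le_Bernoulli: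
  fixes x \<eta> :: real
  assumes "0 \<le> x" "0 < \<eta>" "\<eta> \<le> 1"
  shows "x powr \<eta> \<le> 1 + \<eta> * (x - 1)"
  using assms powr_less_Bernoulli[of x \<eta>] by (cases "x = 1"; cases "\<eta> = 1") auto

text \<open>For an exponent in (0,1] the power lies between 1 and \<open>x\<close>, on whichever
  side of 1 \<open>x\<close> is.\<close>

lemma abs_powr_minus_one_le:
  fixes x \<eta> :: real
  assumes "0 \<le> x" "0 < \<eta>" "\<eta> \<le> 1"
  shows "\<bar>x powr \<eta> - 1\<bar> \<le> \<bar>x - 1\<bar>"
proof (cases "1 \<le> x")
  case True
  then have "x powr \<eta> \<le> x" "1 \<le> x powr \<eta>"
    using assms powr_mono[of \<eta> 1 x] by (auto intro: ge_one_powr_ge_zero)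
  then show ?thesis using True by simp
next
  case False
  then have "x \<le> x powr \<eta>" "x powr \<eta> \<le> 1"
    using assms powr_mono'[of \<eta> 1 x] by (auto intro: powr_le1)
  then show ?thesis using False assms by simp
qed

text \<open>The mean minimises the mean squared deviation. A free centre \<open>c\<close> allows
  comparison with a variable whose mean is different.\<close>

lemma (in prob_space) ext_variance_le_nn_integral_sq:
  assumes Y: "integrable M Y"
  shows "ext_variance M Y \<le> (\<integral>\<^sup>+ \<omega>. ennreal ((Y \<omega> - c)\<^sup>2) \<partial>M)"
proof (cases "(\<integral>\<^sup>+ \<omega>. ennreal ((Y \<omega> - c)\<^sup>2) \<partial>M) = \<infinity>")
  case False
  have [measurable]: "Y \<in> borel_measurable M" using Y by auto
  define m where "m = expectation Y"
  have c: "integrable M (\<lambda>\<omega>. (Y \<omega> - c)\<^sup>2)"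
    using False by (intro integrableI_nonneg) (auto simp: less_top)
  \<comment> \<open>Every term on the right is integrable, and the linear one has expectation 0
    since \<open>m\<close> is the mean.\<close>
  have eq: "(Y \<omega> - m)\<^sup>2 = (Y \<omega> - c)\<^sup>2 - 2 * (m - c) * (Y \<omega> - m) - (m - c)\<^sup>2" for \<omega>
    by (simp add: power2_eq_square algebra_simps)
  have m: "integrable M (\<lambda>\<omega>. (Y \<omega> - m)\<^sup>2)"
    unfolding eq using c Y by auto
  have "expectation (\<lambda>\<omega>. (Y \<omega> - m)\<^sup>2) = expectation (\<lambda>\<omega>. (Y \<omega> - c)\<^sup>2) - (m - c)\<^sup>2"
    unfolding eq using c Y by (simp add: prob_space m_def)
  then have "expectation (\<lambda>\<omega>. (Y \<omega> - m)\<^sup>2) \<le> expectation (\<lambda>\<omega>. (Y \<omega> - c)\<^sup>2)"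
    by simp
  then show ?thesis
    using Y by (simp add: ext_variance_def m_def[symmetric] nn_integral_eq_integral m c ennreal_leI)
qed (metis infinity_ennreal_def top_greatest)

text \<open>The zero set of \<open>q\<close> is null for the law with density \<open>q\<close>,
  hence by domination for the one with density \<open>f\<close>.\<close>

lemma dominates_AE_zero:
  assumes "prob_density f" "prob_density q" "dominates q f"
  shows "AE x in lborel. q x = 0 \<longrightarrow> f x = 0"
proof -
  have [measurable]: "f \<in> borel_measurable borel" "q \<in> borel_measurable borel"
    and f0: "\<And>x. 0 \<le> f x" and q0: "\<And>x. 0 \<le> q x"
    using assms by (auto simp: prob_density_def)
  have "{x. q x = 0} \<in> null_sets (density lborel (\<lambda>x. ennreal (q x)))"
    by (subst null_sets_density_iff) auto
  then have "{x. q x = 0} \<in> null_sets (density lborel (\<lambda>x. ennreal (f x)))"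
    using assms(3) by (auto simp: dominates_def absolutely_continuous_def)
  then have "AE x in lborel. x \<in> {x. q x = 0} \<longrightarrow> ennreal (f x) = 0"
    by (subst (asm) null_sets_density_iff) auto
  then show ?thesis
    by eventually_elim (use f0 in \<open>auto simp: ennreal_eq_0_iff intro: antisym\<close>)
qed

theorem lemma1:
  fixes f q :: "real ^ 'd \<Rightarrow> real"
    and M :: "'w measure"
    and X :: "'w \<Rightarrow> real ^ 'd"
    and W :: "real ^ 'd \<Rightarrow> real"
  assumes "prob_density f"
    and "prob_density q"
    and "dominates q f"
    and "prob_space M"
    and "distributed M lborel X (\<lambda>x. ennreal (q x))"
    and "W = (\<lambda>x. f x / q x)"
  shows "\<forall>\<eta>::real. 0 < \<eta> \<and> \<eta> \<le> 1 \<longrightarrow>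
      (\<integral>\<^sup>+ \<omega>. ennreal (W (X \<omega>) powr \<eta>) \<partial>M) \<le> 1 \<and>
      ext_variance M (\<lambda>\<omega>. W (X \<omega>) powr \<eta>) \<le> ext_variance M (\<lambda>\<omega>. W (X \<omega>)) \<and>
      (\<not> (AE x in lborel. q x = f x) \<longrightarrow>
        ((\<integral>\<^sup>+ \<omega>. ennreal (W (X \<omega>) powr \<eta>) \<partial>M) = 1 \<and>
         ext_variance M (\<lambda>\<omega>. W (X \<omega>) powr \<eta>) = ext_variance M (\<lambda>\<omega>. W (X \<omega>))
         \<longleftrightarrow> \<eta> = 1))"
proof (intro allI impI)
  fix \<eta> :: real
  assume \<eta>: "0 < \<eta> \<and> \<eta> \<le> 1"
  interpret prob_space M by fact
  have [measurable]: "f \<in> borel_measurable borel" "q \<in> borel_measurable borel"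
    and f0: "\<And>x. 0 \<le> f x" and q0: "\<And>x. 0 \<le> q x"
    using assms by (auto simp: prob_density_def)
  have Xm: "X \<in> measurable M lborel"
    using assms(5) by (rule distributed_measurable)
  then have [measurable]: "X \<in> borel_measurable M" by simp
  have Wm[measurable]: "W \<in> borel_measurable borel" unfolding assms(6) by measurable
  have W0: "0 \<le> W x" for x using f0 q0 by (simp add: assms(6))
  have zero: "AE x in lborel. q x = 0 \<longrightarrow> f x = 0"
    using assms(1-3) by (rule dominates_AE_zero)
  define Z where "Z = (\<lambda>\<omega>. W (X \<omega>))"
  have [measurable]: "Z \<in> borel_measurable M" unfolding Z_def by measurable
  have Z0: "0 \<le> Z \<omega>" for \<omega> by (simp add: Z_def W0)
  have "(\<integral>\<^sup>+ \<omega>. ennreal (Z \<omega>) \<partial>M) = (\<integral>\<^sup>+ x. ennreal (q x) * ennreal (W x) \<partial>lborel)"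
    unfolding Z_def by (rule distributed_nn_integral[OF assms(5), symmetric]) simp
  \<comment> \<open>Where \<open>q x = 0\<close> the product on the left is 0, and
    \<open>zero\<close> makes \<open>f x\<close> vanish there almost everywhere; elsewhere
    \<open>q x\<close> cancels.\<close>
  also have "\<dots> = (\<integral>\<^sup>+ x. ennreal (f x) \<partial>lborel)"
    by (rule nn_integral_cong_AE, use zero in eventually_elim)
       (use f0 q0 in \<open>auto simp: assms(6) ennreal_mult[symmetric]\<close>)
  finally have nnZ: "(\<integral>\<^sup>+ \<omega>. ennreal (Z \<omega>) \<partial>M) = 1"
    using assms(1) by (simp add: prob_density_def)
  then have Z: "integrable M Z" by (intro integrableI_nonneg) (auto simp: Z0)
  have EZ: "expectation Z = 1"
    using nnZ by (simp add: integral_eq_nn_integral Z0)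
  define Y where "Y = (\<lambda>\<omega>. Z \<omega> powr \<eta>)"
  have [measurable]: "Y \<in> borel_measurable M" unfolding Y_def by measurable
  have Y0: "0 \<le> Y \<omega>" for \<omega> by (simp add: Y_def)
  have bern: "Y \<omega> \<le> 1 + \<eta> * (Z \<omega> - 1)" for \<omega>
    unfolding Y_def using \<eta> Z0 by (intro powr_le_Bernoulli) auto
  have R: "integrable M (\<lambda>\<omega>. 1 + \<eta> * (Z \<omega> - 1))" using Z by auto
  have ER: "expectation (\<lambda>\<omega>. 1 + \<eta> * (Z \<omega> - 1)) = 1" using Z EZ by (simp add: prob_space)
  \<comment> \<open>Integrability keeps \<open>ext_variance M Y\<close> out of its default value
    infinity.\<close>
  have Y: "integrable M Y"
  proof (rule Bochner_Integration.integrable_bound[OF R])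
    show "AE \<omega> in M. norm (Y \<omega>) \<le> norm (1 + \<eta> * (Z \<omega> - 1))"
      using bern Y0 by (intro AE_I2) (metis abs_of_nonneg order_trans real_norm_def)
  qed simp
  have nnY: "(\<integral>\<^sup>+ \<omega>. ennreal (Y \<omega>) \<partial>M) = ennreal (expectation Y)"
    using Y Y0 by (simp add: nn_integral_eq_integral)
  have EY: "expectation Y \<le> 1" using integral_mono[OF Y R bern] ER by simp
  \<comment> \<open>The centre 1 is the mean of \<open>Z\<close>, so the chain ends in exactly the
    variance of \<open>Z\<close>, although \<open>Y\<close> may have a smaller mean.\<close>
  have "ext_variance M Y \<le> (\<integral>\<^sup>+ \<omega>. ennreal ((Y \<omega> - 1)\<^sup>2) \<partial>M)"
    using Y by (rule ext_variance_le_nn_integral_sq)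
  also have "\<dots> \<le> (\<integral>\<^sup>+ \<omega>. ennreal ((Z \<omega> - 1)\<^sup>2) \<partial>M)"
    using \<eta> Z0 unfolding Y_def
    by (intro nn_integral_mono ennreal_leI) (simp add: abs_powr_minus_one_le flip: abs_le_square_iff)
  also have "\<dots> = ext_variance M Z"
    using Z EZ by (simp add: ext_variance_def)
  finally have var: "ext_variance M Y \<le> ext_variance M Z" .
  have strict: "AE x in lborel. q x = f x" if "expectation Y = 1" "\<eta> \<noteq> 1"
  proof -
    have "expectation (\<lambda>\<omega>. 1 + \<eta> * (Z \<omega> - 1) - Y \<omega>) = 0"
      using R Y ER that by (subst Bochner_Integration.integral_diff) auto
    then have "AE \<omega> in M. 1 + \<eta> * (Z \<omega> - 1) - Y \<omega> = 0"
      using R Y bern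
      by (subst (asm) integral_nonneg_eq_0_iff_AE) auto
    then have "AE \<omega> in M. W (X \<omega>) = 1"
    proof eventually_elim
      case (elim \<omega>)
      show ?case
      proof (rule ccontr)
        assume "W (X \<omega>) \<noteq> 1"
        then have "Y \<omega> < 1 + \<eta> * (Z \<omega> - 1)"
          unfolding Y_def using \<eta> that Z0 by (intro powr_less_Bernoulli) (auto simp: Z_def)
        then show False using elim by simp
      qed
    qed
    \<comment> \<open>The law of \<open>X\<close> only sees points with \<open>q x > 0\<close>; at
      the others \<open>zero\<close> yields \<open>f x = 0 = q x\<close> almost everywhere.\<close>
    then have "AE x in lborel. 0 < ennreal (q x) \<longrightarrow> W x = 1"
      by (subst (asm) distributed_AE2[OF assms(5)]) auto
    then show ?thesis
      using zero
    proof eventually_elim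
      case (elim x)
      then show ?case using q0[of x] by (cases "q x = 0") (auto simp: assms(6))
    qed
  qed
  \<comment> \<open>This serves the direction from \<open>\<eta> = 1\<close> to the two equalities,
    including the case of infinite variance.\<close>
  have YZ: "Y = Z" if "\<eta> = 1" using that Z0 by (auto simp: Y_def)
  show "(\<integral>\<^sup>+ \<omega>. ennreal (W (X \<omega>) powr \<eta>) \<partial>M) \<le> 1 \<and>
      ext_variance M (\<lambda>\<omega>. W (X \<omega>) powr \<eta>) \<le> ext_variance M (\<lambda>\<omega>. W (X \<omega>)) \<and>
      (\<not> (AE x in lborel. q x = f x) \<longrightarrow>
        ((\<integral>\<^sup>+ \<omega>. ennreal (W (X \<omega>) powr \<eta>) \<partial>M) = 1 \<and>
         ext_variance M (\<lambda>\<omega>. W (X \<omega>) powr \<eta>) = ext_variance M (\<lambda>\<omega>. W (X \<omega>))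
         \<longleftrightarrow> \<eta> = 1))"
    using var nnY EY strict YZ EZ unfolding Y_def Z_def by auto
qed

end
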